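(* Let $K$ satisfy the kernel assumption, let $q\ge1$, and let $n\to\infty$, $b=b_n\to0$, $nb\to\infty$. Suppose that (S1) is fulfilled with some $1\ge\alpha>0$. Then uniformly in $u\in[0,1]$, $$\frac1n\sum_{t=1}^nK_b\big(\tfrac tn-u\big)\{\mathbb{E}X_{t,n}-\mathbb{E}\tilde X_t(t/n)\}=O(n^{-\alpha})\qquad(1)$$ and $$\frac1n\sum_{t=1}^nK_b\big(\tfrac tn-u\big)\{\mathbb{E}\tilde X_t(t/n)-\mathbb{E}\tilde X_0(u)\}=O(b^\alpha)+O(n^{-1}).$$ Now assume additionally that $K$ is symmetric. (a) If (S3) holds, then (1) is valid with $\alpha=1$, and uniformly in $u\in[\frac b2,1-\frac b2]$, $$\frac1n\sum_{t=1}^nK_b\big(\tfrac tn-u\big)\{\mathbb{E}\tilde X_t(t/n)-\mathbb{E}\tilde X_0(u)\}=o(b)+O(n^{-1}).\qquad(2)$$ (b) Suppose that $[0,1]\to L^q$, $u\mapsto\tilde X_0(u)$ is Fréchet differentiable with derivative $\tilde D_0(u)$, i.e. for all $u\in[0,1]$, $$\lim_{h\to0}\Big\|\frac{\tilde X_0(u+h)-\tilde X_0(u)}{h}-\tilde D_0(u)\Big\|_q=0.$$ Then the statement of (a) holds, i.e. (1) is valid with $\alpha=1$ and (2) holds uniformly in $u\in[\frac b2,1-\frac b2]$.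
   Context: $\|W\|_q:=(\mathbb{E}|W|^q)^{1/q}$; $K_b(x):=\frac1bK(\frac xb)$. $X_{t,n}$, $t=1,\dots,n$, is a triangular array of real stochastic processes, and for each $u\in[0,1]$, $\tilde X_t(u)$, $t\in\mathbb{Z}$, is a stationary and ergodic process. (S1) $\sup_{u\in[0,1]}\|\tilde X_t(u)\|_q<\infty$, and there exist $1\ge\alpha>0$, $C_B>0$ such that uniformly in $t=1,\dots,n$ and $u,v\in[0,1]$: $\|\tilde X_t(u)-\tilde X_t(v)\|_q\le C_B|u-v|^\alpha$ and $\|X_{t,n}-\tilde X_t(t/n)\|_q\le C_Bn^{-\alpha}$. (S3) $\alpha=1$ (in (S1)), $u\mapsto\tilde X_t(u)$ is a.s. continuously differentiable for all $t\in\mathbb{Z}$ and $\|\sup_{u\in[0,1]}|\partial_u\tilde X_t(u)|\|_q<\infty$. Kernel assumption: $K:\mathbb{R}\to\mathbb{R}$ is bounded, of bounded variation, with compact support $[-\frac12,\frac12]$ and $\int K\,dx=1$.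
   Formalization: In (b), (1) with rate 1/n is claimed only when (S1) holds with α=1, and (2) only when u↦D̃_0(u) is continuous into L^q; without these (b) fails, e.g. X_{t,n}=X̃_t(t/n)+n^{-α} with α<1 and X̃ constant for (1), X̃_t(u)=u² sin(1/u) for (2). *)

theory Defs
  imports "HOL-Probability.Probability" "HOL-Library.Landau_Symbols"
begin

text \<open>
  Membership in $L^q$ and the $L^q$-norm. The Bochner integral of a non-integrable function
  is 0, so \<open>Lq_norm\<close> is meaningful only together with \<open>in_Lq\<close>; the condition
  $\|W\|_q < \infty$ is \<open>in_Lq M q W\<close>.
\<close>

definition in_Lq :: "'a measure \<Rightarrow> real \<Rightarrow> ('a \<Rightarrow> real) \<Rightarrow> bool" where
  "in_Lq M q W \<longleftrightarrow> W \<in> borel_measurable M \<and> integrable M (\<lambda>\<omega>. \<bar>W \<omega>\<bar> powr q)"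

definition Lq_norm :: "'a measure \<Rightarrow> real \<Rightarrow> ('a \<Rightarrow> real) \<Rightarrow> real" where
  "Lq_norm M q W = (\<integral>\<omega>. \<bar>W \<omega>\<bar> powr q \<partial>M) powr (1 / q)"

text \<open>Strict stationarity and ergodicity are properties of the law on the path space.\<close>

definition path_space :: "(int \<Rightarrow> real) measure" where
  "path_space = (\<Pi>\<^sub>M t\<in>UNIV. borel)"

definition path_law :: "'a measure \<Rightarrow> (int \<Rightarrow> 'a \<Rightarrow> real) \<Rightarrow> (int \<Rightarrow> real) measure" where
  "path_law M Y = distr M path_space (\<lambda>\<omega> t. Y t \<omega>)"

definition path_shift :: "(int \<Rightarrow> real) \<Rightarrow> int \<Rightarrow> real" where
  "path_shift x = (\<lambda>t. x (t + 1))"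

definition stationary_process :: "'a measure \<Rightarrow> (int \<Rightarrow> 'a \<Rightarrow> real) \<Rightarrow> bool" where
  "stationary_process M Y \<longleftrightarrow>
     (\<forall>t. Y t \<in> borel_measurable M) \<and>
     distr (path_law M Y) path_space path_shift = path_law M Y"

definition ergodic_process :: "'a measure \<Rightarrow> (int \<Rightarrow> 'a \<Rightarrow> real) \<Rightarrow> bool" where
  "ergodic_process M Y \<longleftrightarrow>
     (\<forall>A\<in>sets path_space. path_shift -` A = A \<longrightarrow> measure (path_law M Y) A \<in> {0, 1})"

definition cond_S1 ::
  "'a measure \<Rightarrow> real \<Rightarrow> real \<Rightarrow> (nat \<Rightarrow> nat \<Rightarrow> 'a \<Rightarrow> real) \<Rightarrow> (int \<Rightarrow> real \<Rightarrow> 'a \<Rightarrow> real) \<Rightarrow> bool"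
where
  "cond_S1 M q \<alpha> X Xt \<longleftrightarrow>
     0 < \<alpha> \<and> \<alpha> \<le> 1 \<and>
     (\<forall>t. (\<forall>u\<in>{0..1}. in_Lq M q (Xt t u)) \<and> bdd_above ((\<lambda>u. Lq_norm M q (Xt t u)) ` {0..1})) \<and>
     (\<exists>C>0. \<forall>n. \<forall>t\<in>{1..n}.
        (\<forall>u\<in>{0..1}. \<forall>v\<in>{0..1}.
           Lq_norm M q (\<lambda>\<omega>. Xt (int t) u \<omega> - Xt (int t) v \<omega>) \<le> C * \<bar>u - v\<bar> powr \<alpha>) \<and>
        in_Lq M q (\<lambda>\<omega>. X t n \<omega> - Xt (int t) (real t / real n) \<omega>) \<and>
        Lq_norm M q (\<lambda>\<omega>. X t n \<omega> - Xt (int t) (real t / real n) \<omega>) \<le> C * real n powr (- \<alpha>))"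

text \<open>
  \<open>D t u\<close> is the pathwise derivative $\partial_u \tilde X_t(u)$, taken one-sidedly at 0 and 1.
  It is determined only up to a null set, on which the existential leaves it free.
\<close>

definition cond_S3 ::
  "'a measure \<Rightarrow> real \<Rightarrow> real \<Rightarrow> (int \<Rightarrow> real \<Rightarrow> 'a \<Rightarrow> real) \<Rightarrow> bool"
where
  "cond_S3 M q \<alpha> Xt \<longleftrightarrow>
     \<alpha> = 1 \<and>
     (\<exists>D :: int \<Rightarrow> real \<Rightarrow> 'a \<Rightarrow> real. \<forall>t.
        (AE \<omega> in M.
           (\<forall>u\<in>{0..1}. ((\<lambda>v. Xt t v \<omega>) has_real_derivative D t u \<omega>) (at u within {0..1})) \<and>
           continuous_on {0..1} (\<lambda>u. D t u \<omega>)) \<and>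
        in_Lq M q (\<lambda>\<omega>. SUP u\<in>{0..1}. \<bar>D t u \<omega>\<bar>))"

definition Lq_frechet_deriv ::
  "'a measure \<Rightarrow> real \<Rightarrow> (real \<Rightarrow> 'a \<Rightarrow> real) \<Rightarrow> (real \<Rightarrow> 'a \<Rightarrow> real) \<Rightarrow> bool"
where
  "Lq_frechet_deriv M q Y D \<longleftrightarrow>
     (\<forall>u\<in>{0..1}. in_Lq M q (Y u) \<and> in_Lq M q (D u) \<and>
        ((\<lambda>h. Lq_norm M q (\<lambda>\<omega>. (Y (u + h) \<omega> - Y u \<omega>) / h - D u \<omega>)) \<longlongrightarrow> 0)
          (at 0 within {h. u + h \<in> {0..1}}))"

definition Lq_continuous ::
  "'a measure \<Rightarrow> real \<Rightarrow> (real \<Rightarrow> 'a \<Rightarrow> real) \<Rightarrow> bool"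
where
  "Lq_continuous M q D \<longleftrightarrow>
     (\<forall>u\<in>{0..1}. in_Lq M q (D u) \<and>
        ((\<lambda>v. Lq_norm M q (\<lambda>\<omega>. D v \<omega> - D u \<omega>)) \<longlongrightarrow> 0) (at u within {0..1}))"

definition bounded_variation :: "(real \<Rightarrow> real) \<Rightarrow> bool" where
  "bounded_variation f \<longleftrightarrow>
     (\<exists>V. \<forall>(x :: nat \<Rightarrow> real) N. mono x \<longrightarrow> (\<Sum>i<N. \<bar>f (x (Suc i)) - f (x i)\<bar>) \<le> V)"

definition smoothing_kernel :: "(real \<Rightarrow> real) \<Rightarrow> bool" where
  "smoothing_kernel K \<longleftrightarrow>
     bounded (range K) \<and> bounded_variation K \<and>
     (\<forall>x. x \<notin> {-1/2..1/2} \<longrightarrow> K x = 0) \<and>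
     has_bochner_integral lborel K 1"

definition scaled_kernel :: "(real \<Rightarrow> real) \<Rightarrow> real \<Rightarrow> real \<Rightarrow> real" where
  "scaled_kernel K b x = 1 / b * K (x / b)"

text \<open>
  The filter \<open>n \<longlonglongrightarrow> \<infinity>\<close>, uniformly in \<open>u \<in> U n\<close>: with it, the library's Landau symbols
  express bounds that are uniform in \<open>u\<close>.
\<close>

definition uniformly_in :: "(nat \<Rightarrow> real set) \<Rightarrow> (nat \<times> real) filter" where
  "uniformly_in U = inf (filtercomap fst sequentially) (principal (SIGMA n:UNIV. U n))"

lemma eventually_uniformly_in:
  "eventually P (uniformly_in U) \<longleftrightarrow> (\<forall>\<^sub>F n in sequentially. \<forall>u\<in>U n. P (n, u))"
proof
  assume "eventually P (uniformly_in U)"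
  then obtain Q where Q: "eventually Q sequentially"
    and P: "\<And>p. Q (fst p) \<Longrightarrow> p \<in> (SIGMA n:UNIV. U n) \<Longrightarrow> P p"
    unfolding uniformly_in_def eventually_inf_principal eventually_filtercomap by blast
  show "\<forall>\<^sub>F n in sequentially. \<forall>u\<in>U n. P (n, u)"
    using Q by (rule eventually_mono) (auto intro: P)
next
  assume "\<forall>\<^sub>F n in sequentially. \<forall>u\<in>U n. P (n, u)"
  then show "eventually P (uniformly_in U)"
    unfolding uniformly_in_def eventually_inf_principal eventually_filtercomap
    by (intro exI[of _ "\<lambda>n. \<forall>u\<in>U n. P (n, u)"]) auto
qed

text \<open>The left-hand sides of the expansions, as functions of \<open>(n, u)\<close>.\<close>

definition approx_bias ::
  "'a measure \<Rightarrow> (nat \<Rightarrow> nat \<Rightarrow> 'a \<Rightarrow> real) \<Rightarrow> (int \<Rightarrow> real \<Rightarrow> 'a \<Rightarrow> real) \<Rightarrow>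
    (real \<Rightarrow> real) \<Rightarrow> (nat \<Rightarrow> real) \<Rightarrow> nat \<times> real \<Rightarrow> real"
where
  "approx_bias M X Xt K b = (\<lambda>(n, u).
     1 / real n * (\<Sum>t = 1..n. scaled_kernel K (b n) (real t / real n - u) *
       ((\<integral>\<omega>. X t n \<omega> \<partial>M) - (\<integral>\<omega>. Xt (int t) (real t / real n) \<omega> \<partial>M))))"

definition smoothing_bias ::
  "'a measure \<Rightarrow> (int \<Rightarrow> real \<Rightarrow> 'a \<Rightarrow> real) \<Rightarrow>
    (real \<Rightarrow> real) \<Rightarrow> (nat \<Rightarrow> real) \<Rightarrow> nat \<times> real \<Rightarrow> real"
where
  "smoothing_bias M Xt K b = (\<lambda>(n, u).
     1 / real n * (\<Sum>t = 1..n. scaled_kernel K (b n) (real t / real n - u) *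
       ((\<integral>\<omega>. Xt (int t) (real t / real n) \<omega> \<partial>M) - (\<integral>\<omega>. Xt 0 u \<omega> \<partial>M))))"

text \<open>A remainder $o(b) + O(n^{-1})$, uniformly in $u \in [b/2, 1 - b/2]$.\<close>

definition smoothing_bias_small ::
  "'a measure \<Rightarrow> (int \<Rightarrow> real \<Rightarrow> 'a \<Rightarrow> real) \<Rightarrow>
    (real \<Rightarrow> real) \<Rightarrow> (nat \<Rightarrow> real) \<Rightarrow> bool"
where
  "smoothing_bias_small M Xt K b \<longleftrightarrow>
     (\<exists>r\<^sub>1 \<in> o[uniformly_in (\<lambda>n. {b n / 2 .. 1 - b n / 2})](\<lambda>(n, u). b n).
      \<exists>r\<^sub>2 \<in> O[uniformly_in (\<lambda>n. {b n / 2 .. 1 - b n / 2})](\<lambda>(n, u). 1 / real n).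
        smoothing_bias M Xt K b = (\<lambda>p. r\<^sub>1 p + r\<^sub>2 p))"

end

theory Submission
  imports Defs
begin

text \<open>
  Write \<open>g u = E Xt_0(u)\<close>. By stationarity and \<open>|E W| \<le> ||W||_q\<close>, every bias is a weighted mean with
  weights \<open>K_b(t/n - u) / n\<close> of total mass \<open>O(1)\<close>, which gives the first two bounds. Both (a) and (b) make
  \<open>g\<close> continuously differentiable, hence \<open>g(t/n) - g(u) = g'(u) (t/n - u) + o(b)\<close> uniformly on the window.
  It remains to bound \<open>S = \<Sum>\<^sub>t \<phi>(x\<^sub>t)\<close> for the odd function \<open>\<phi>(y) = y K(y)\<close> of bounded variation on the grid
  \<open>x\<^sub>t = (t/n - u)/b\<close>. No integral is needed: reflecting the grid at 0 yields a translated grid interlaced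
  with the original one, so \<open>2 S = \<Sum>\<^sub>t (\<phi>(x\<^sub>t) - \<phi>(x\<^sub>t + \<delta>))\<close> is, up to a boundary term, at most the
  variation of \<open>\<phi>\<close>.
\<close>

section \<open>Bounded variation and the discrete first moment of the kernel\<close>

text \<open>Interlaced grids merge into one monotone sequence \<open>z\<close> with \<open>x\<close>
  at the even and \<open>y\<close> at the odd positions. The sum then consists of every second
  increment of \<open>f\<close> along \<open>z\<close>, so the variation of \<open>f\<close> bounds
  it independently of grids and length.\<close>

lemma bounded_variation_interlaced:
  assumes "bounded_variation f"
  obtains V where "\<And>(x :: nat \<Rightarrow> real) y N. (\<And>t. x t \<le> y t \<and> y t \<le> x (Suc t)) \<Longrightarrow>
    (\<Sum>t<N. \<bar>f (x t) - f (y t)\<bar>) \<le> V"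
proof -
  obtain V where V: "\<And>(z :: nat \<Rightarrow> real) N. mono z \<Longrightarrow> (\<Sum>i<N. \<bar>f (z (Suc i)) - f (z i)\<bar>) \<le> V"
    using assms unfolding bounded_variation_def by blast
  have "(\<Sum>t<N. \<bar>f (x t) - f (y t)\<bar>) \<le> V"
    if xy: "\<And>t. x t \<le> y t \<and> y t \<le> x (Suc t)" for x y :: "nat \<Rightarrow> real" and N
  proof -
    define z where "z i = (if even i then x (i div 2) else y (i div 2))" for i :: nat
    have "z i \<le> z (Suc i)" for i
    proof (cases "even i")
      case True
      then show ?thesis using xy[of "i div 2"] by (simp add: z_def)
    next
      case False
      then show ?thesis using xy[of "i div 2"] by (simp add: z_def odd_Suc_div_two)
    qed
    then have "mono z"
      by (simp add: mono_iff_le_Suc)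
    have "(\<Sum>t<N. \<bar>f (x t) - f (y t)\<bar>) \<le> (\<Sum>i<2 * N. \<bar>f (z (Suc i)) - f (z i)\<bar>)"
      by (induction N) (auto simp: z_def abs_minus_commute)
    also have "\<dots> \<le> V"
      by (rule V) fact
    finally show ?thesis .
  qed
  then show ?thesis by (rule that)
qed

text \<open>The identity has unbounded variation on the line, but outside [-1/2, 1/2] the factor
  \<open>K\<close> is 0. So it may be replaced by its truncation \<open>c\<close>, which is monotone
  and bounded, and a product of bounded functions of bounded variation is again of bounded
  variation.\<close>

lemma bounded_variation_mult_ident:
  assumes "bounded_variation K" and B: "\<And>x. \<bar>K x\<bar> \<le> B"
    and supp: "\<And>x. x \<notin> {-1/2..1/2} \<Longrightarrow> K x = 0"
  shows "bounded_variation (\<lambda>y. y * K y)"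
proof -
  obtain V where V: "\<And>(x :: nat \<Rightarrow> real) N. mono x \<Longrightarrow> (\<Sum>i<N. \<bar>K (x (Suc i)) - K (x i)\<bar>) \<le> V"
    using assms(1) unfolding bounded_variation_def by blast
  define c :: "real \<Rightarrow> real" where "c y = max (-1/2) (min (1/2) y)" for y
  have c: "y * K y = c y * K y" for y
    using supp[of y] by (cases "y \<in> {-1/2..1/2}") (auto simp: c_def)
  have cb: "\<bar>c y\<bar> \<le> 1 / 2" for y
    by (auto simp: c_def)
  have "(\<Sum>i<N. \<bar>c (x (Suc i)) * K (x (Suc i)) - c (x i) * K (x i)\<bar>) \<le> 1 / 2 * V + B" if x: "mono x" for x N
  proof -
    have cm: "c (x i) \<le> c (x (Suc i))" for i
      using monoD[OF x, of i "Suc i"] by (auto simp: c_def)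
    have "(\<Sum>i<N. \<bar>c (x (Suc i)) * K (x (Suc i)) - c (x i) * K (x i)\<bar>)
      \<le> (\<Sum>i<N. 1 / 2 * \<bar>K (x (Suc i)) - K (x i)\<bar> + B * (c (x (Suc i)) - c (x i)))"
    proof (rule sum_mono)
      fix i
      have B0: "0 \<le> B" using B[of 0] by linarith
      have "c (x (Suc i)) * K (x (Suc i)) - c (x i) * K (x i) =
        c (x (Suc i)) * (K (x (Suc i)) - K (x i)) + K (x i) * (c (x (Suc i)) - c (x i))"
        by (simp add: algebra_simps)
      also have "\<bar>\<dots>\<bar> \<le> \<bar>c (x (Suc i))\<bar> * \<bar>K (x (Suc i)) - K (x i)\<bar> + \<bar>K (x i)\<bar> * \<bar>c (x (Suc i)) - c (x i)\<bar>"
        by (metis abs_mult abs_triangle_ineq)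
      also have "\<dots> \<le> 1 / 2 * \<bar>K (x (Suc i)) - K (x i)\<bar> + B * (c (x (Suc i)) - c (x i))"
        using cm[of i] B0 by (intro add_mono mult_mono cb B) auto
      finally show "\<bar>c (x (Suc i)) * K (x (Suc i)) - c (x i) * K (x i)\<bar> \<le>
        1 / 2 * \<bar>K (x (Suc i)) - K (x i)\<bar> + B * (c (x (Suc i)) - c (x i))" .
    qed
    \<comment> \<open>Since \<open>c\<close> is monotone along \<open>x\<close>, its increments
      carry no absolute value and telescope; their total is at most 1, the length of
      [-1/2, 1/2].\<close>
    also have "\<dots> = 1 / 2 * (\<Sum>i<N. \<bar>K (x (Suc i)) - K (x i)\<bar>) + B * (c (x N) - c (x 0))"
      by (simp add: sum.distrib sum_lessThan_telescope[of "\<lambda>i. c (x i)"] flip: sum_distrib_left sum_divide_distrib)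
    also have "\<dots> \<le> 1 / 2 * V + B * 1"
    proof (intro add_mono mult_left_mono V x)
      show "c (x N) - c (x 0) \<le> 1" using cb[of "x N"] cb[of "x 0"] by linarith
      show "0 \<le> B" using B[of 0] by linarith
    qed simp
    finally show ?thesis by simp
  qed
  then show ?thesis
    unfolding bounded_variation_def c by blast
qed

text \<open>The constant is free of \<open>n\<close>, \<open>b\<close> and \<open>u\<close>, so
  division by \<open>n\<close> makes the linear term of a Taylor expansion O(1/n). The restriction
  on \<open>u\<close> keeps the support of the kernel inside [0, 1], so that the grid is not cut off
  on one side of \<open>u\<close> only.\<close>

lemma kernel_first_moment_bound:
  assumes "bounded_variation K" and B: "\<And>x. \<bar>K x\<bar> \<le> B"
    and supp: "\<And>x. x \<notin> {-1/2..1/2} \<Longrightarrow> K x = 0"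
    and sym: "\<And>x. K (- x) = K x"
  obtains C where "\<And>n b u. n \<ge> 1 \<Longrightarrow> b > 0 \<Longrightarrow> u \<in> {b / 2..1 - b / 2} \<Longrightarrow>
    \<bar>\<Sum>t = 1..n. scaled_kernel K b (real t / real n - u) * (real t / real n - u)\<bar> \<le> C"
proof -
  define \<phi> where "\<phi> y = y * K y" for y
  have "bounded_variation \<phi>"
    using bounded_variation_mult_ident[OF assms(1) B supp] by (simp add: \<phi>_def[abs_def])
  then obtain V where V: "\<And>(x :: nat \<Rightarrow> real) y N. (\<And>t. x t \<le> y t \<and> y t \<le> x (Suc t)) \<Longrightarrow>
    (\<Sum>t<N. \<bar>\<phi> (x t) - \<phi> (y t)\<bar>) \<le> V"
    by (metis bounded_variation_interlaced)
  have odd: "\<phi> (- y) = - \<phi> y" for y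
    by (simp add: \<phi>_def sym)
  have \<phi>0: "\<phi> y = 0" if "y \<notin> {-1/2..1/2}" for y
    using supp[OF that] by (simp add: \<phi>_def)
  have B0: "0 \<le> B" using B[of 0] by linarith
  have \<phi>B: "\<bar>\<phi> y\<bar> \<le> B" for y
  proof (cases "y \<in> {-1/2..1/2}")
    case True
    then have "\<bar>y\<bar> * \<bar>K y\<bar> \<le> 1 * B"
      by (intro mult_mono B) auto
    then show ?thesis by (simp add: \<phi>_def abs_mult)
  qed (simp add: \<phi>0 B0)
  have "\<bar>\<Sum>t = 1..n. scaled_kernel K b (real t / real n - u) * (real t / real n - u)\<bar> \<le> V / 2 + B"
    if n: "n \<ge> 1" and b: "b > 0" and u: "u \<in> {b / 2..1 - b / 2}" for n :: nat and b u :: real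
  proof -
    define x where "x t = (real t / real n - u) / b" for t :: nat
    \<comment> \<open>The reflection v to 2u - v does not preserve the grid of points t/n unless 2un
      is an integer. The map t to m - t is its best integer substitute from below, and
      \<open>\<delta>\<close> is the remaining offset in units of \<open>b\<close>, between 0 and
      the mesh 1/(nb).\<close>
    define m where "m = nat \<lfloor>2 * u * n\<rfloor>"
    define \<delta> where "\<delta> = (2 * u - real m / real n) / b"
    have u0: "0 \<le> 2 * u * n" using u b n by auto
    have m: "real m \<le> 2 * u * n" "2 * u * n < real m + 1"
      using u0 unfolding m_def by linarith+
    \<comment> \<open>Beyond \<open>m\<close> the grid has passed 2u, hence is further than u \<ge>
      b/2 to the right of \<open>u\<close>; beyond \<open>n\<close> it is further than 1 - u \<ge>
      b/2. Strictness matters because \<open>K\<close> may be nonzero at 1/2.\<close>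
    have vanish_m: "\<phi> (x t) = 0" if "m < t" for t
    proof (rule \<phi>0)
      have "2 * u * n < real t" using m that by linarith
      then have "u < real t / real n - u" using n by (simp add: field_simps)
      moreover have "b / 2 \<le> u" using u by simp
      ultimately have "b / 2 < real t / real n - u" by linarith
      then have "1 / 2 < x t" using b by (simp add: x_def field_simps)
      then show "x t \<notin> {-1/2..1/2}" by simp
    qed
    have vanish_n: "\<phi> (x t) = 0" if "n < t" for t
    proof (rule \<phi>0)
      have "1 < real t / real n" using n that by simp
      moreover have "u \<le> 1 - b / 2" using u by simp
      ultimately have "b / 2 < real t / real n - u" by linarith
      then have "1 / 2 < x t" using b by (simp add: x_def field_simps)
      then show "x t \<notin> {-1/2..1/2}" by simp
    qed
    have refl: "\<phi> (x (m - t)) = - \<phi> (x t + \<delta>)" if "t \<le> m" for t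
    proof -
      have "x (m - t) = - (x t + \<delta>)"
        using that b n by (simp add: x_def \<delta>_def of_nat_diff field_simps)
      then show ?thesis by (simp only: odd)
    qed
    have "(\<Sum>t = 1..n. scaled_kernel K b (real t / real n - u) * (real t / real n - u)) = (\<Sum>t = 1..n. \<phi> (x t))"
      by (simp add: scaled_kernel_def \<phi>_def x_def mult.commute)
    \<comment> \<open>Either of \<open>m\<close> and \<open>n\<close> may be the larger one, so the
      upper limit \<open>n\<close> is exchanged for \<open>m\<close> through the common limit
      \<open>m + n\<close>. The index 0 is added to make the range invariant under t to m - t. Its
      term stays as a correction: x 0 = -u/b may equal -1/2, where \<open>K\<close> need not
      vanish.\<close>
    also have "\<dots> = (\<Sum>t = 1..m + n. \<phi> (x t))"
      by (rule sum.mono_neutral_left) (auto intro: vanish_n)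
    also have "\<dots> = (\<Sum>t = 0..m + n. \<phi> (x t)) - \<phi> (x 0)"
      by (simp add: sum.atLeast_Suc_atMost)
    also have "(\<Sum>t = 0..m + n. \<phi> (x t)) = (\<Sum>t<Suc m. \<phi> (x t))"
      by (rule sum.mono_neutral_right) (auto intro: vanish_m)
    finally have eq: "(\<Sum>t = 1..n. scaled_kernel K b (real t / real n - u) * (real t / real n - u)) =
      (\<Sum>t<Suc m. \<phi> (x t)) - \<phi> (x 0)" .
    have "(\<Sum>t<Suc m. \<phi> (x t)) = (\<Sum>t<Suc m. \<phi> (x (m - t)))"
      using sum.nat_diff_reindex[of "\<lambda>t. \<phi> (x t)" "Suc m"] by simp
    also have "\<dots> = - (\<Sum>t<Suc m. \<phi> (x t + \<delta>))"
      by (simp add: refl sum_negf del: sum.lessThan_Suc)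
    \<comment> \<open>The sum equals minus the sum over the shifted grid; averaging both forms
      leaves only differences between neighbouring points.\<close>
    finally have "2 * (\<Sum>t<Suc m. \<phi> (x t)) = (\<Sum>t<Suc m. \<phi> (x t) - \<phi> (x t + \<delta>))"
      by (simp add: sum_subtractf)
    also have "\<bar>\<dots>\<bar> \<le> (\<Sum>t<Suc m. \<bar>\<phi> (x t) - \<phi> (x t + \<delta>)\<bar>)"
      by (rule sum_abs)
    also have "\<dots> \<le> V"
    proof (rule V)
      fix t
      have "m / n \<le> 2 * u" "2 * u \<le> (m + 1) / n"
        using m n by (simp_all add: pos_le_divide_eq pos_divide_le_eq)
      then have "0 \<le> 2 * u - m / n" "2 * u - m / n \<le> 1 / n"
        by (simp_all add: add_divide_distrib)
      then have "0 \<le> \<delta>" "\<delta> \<le> 1 / n / b"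
        unfolding \<delta>_def using b by (simp, intro divide_right_mono) auto
      moreover have "x (Suc t) = x t + 1 / n / b"
        by (simp add: x_def add_divide_distrib diff_divide_distrib)
      ultimately show "x t \<le> x t + \<delta> \<and> x t + \<delta> \<le> x (Suc t)"
        by simp
    qed
    finally show ?thesis
      using eq \<phi>B[of "x 0"] by (simp del: sum.lessThan_Suc)
  qed
  then show ?thesis by (rule that)
qed

section \<open>Kernel-weighted means and uniform linearization\<close>

lemma card_grid_window:
  fixes a L :: real
  assumes "L \<ge> 0"
  shows "real (card {t \<in> {1..n :: nat}. a \<le> real t \<and> real t \<le> a + L}) \<le> L + 1"
proof -
  let ?S = "{t \<in> {1..n :: nat}. a \<le> real t \<and> real t \<le> a + L}"
  have "card ?S = card (int ` ?S)"
    by (simp add: card_image)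
  also have "\<dots> \<le> card {\<lceil>a\<rceil>..\<lfloor>a + L\<rfloor>}"
    by (rule card_mono) (auto simp: ceiling_le_iff le_floor_iff)
  also have "\<dots> = nat (\<lfloor>a + L\<rfloor> - \<lceil>a\<rceil> + 1)"
    by simp
  finally show ?thesis
    using assms by linarith
qed

text \<open>Only the points t/n within b/2 of \<open>u\<close> carry weight. There are at most nb +
  1 of them, each with weight at most B/b. The factor 2 absorbs the extra point, by nb \<ge> 1. No
  position of \<open>u\<close> is excluded, since a window cut off by the boundary only has fewer
  points.\<close>

lemma kernel_weighted_mean_bound:
  assumes B: "\<And>x. \<bar>K x\<bar> \<le> B" and supp: "\<And>x. x \<notin> {-1/2..1/2} \<Longrightarrow> K x = 0"
    and b: "b > 0" and nb: "real n * b \<ge> 1" and c: "c \<ge> 0"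
    and f: "\<And>t. t \<in> {1..n} \<Longrightarrow> \<bar>real t / real n - u\<bar> \<le> b / 2 \<Longrightarrow> \<bar>f t\<bar> \<le> c"
  shows "\<bar>1 / real n * (\<Sum>t = 1..n. scaled_kernel K b (real t / real n - u) * f t)\<bar> \<le> 2 * B * c"
proof -
  have n: "real n > 0" using nb b by (cases n) auto
  have B0: "0 \<le> B" using B[of 0] by linarith
  \<comment> \<open>In terms of \<open>t\<close>, the window is an interval of length nb starting at
    nu - nb/2, the form required for counting integers.\<close>
  let ?S = "{t \<in> {1..n}. n * u - n * b / 2 \<le> real t \<and> real t \<le> (n * u - n * b / 2) + n * b}"
  have S: "t \<in> ?S \<longleftrightarrow> \<bar>real t / real n - u\<bar> \<le> b / 2" if "t \<in> {1..n}" for t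
  proof -
    have "real t / real n - u = (real t - n * u) / n" using n by (simp add: diff_divide_distrib)
    then have "\<bar>real t / real n - u\<bar> = \<bar>real t - n * u\<bar> / n"
      using n by simp
    then have "\<bar>real t / real n - u\<bar> \<le> b / 2 \<longleftrightarrow> \<bar>real t - n * u\<bar> \<le> n * b / 2"
      using n by (simp add: pos_divide_le_eq mult.commute)
    also have "\<dots> \<longleftrightarrow> n * u - n * b / 2 \<le> real t \<and> real t \<le> n * u - n * b / 2 + n * b"
      unfolding abs_le_iff by linarith
    finally show ?thesis
      by (simp only: mem_Collect_eq that simp_thms)
  qed
  have out: "scaled_kernel K b (real t / real n - u) = 0" if "t \<in> {1..n} - ?S" for t
  proof -
    have "\<not> \<bar>real t / real n - u\<bar> \<le> b / 2" using S[of t] that by blast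
    then have "1 / 2 < \<bar>(real t / real n - u) / b\<bar>"
      using b by (simp add: abs_divide pos_less_divide_eq)
    moreover have "K z = 0" if "1 / 2 < \<bar>z\<bar>" for z
      using that by (intro supp) auto
    ultimately have "K ((real t / real n - u) / b) = 0"
      by iprover
    then show ?thesis by (simp only: scaled_kernel_def mult_zero_right)
  qed
  have sum_eq: "(\<Sum>t = 1..n. scaled_kernel K b (real t / real n - u) * f t) =
    (\<Sum>t\<in>?S. scaled_kernel K b (real t / real n - u) * f t)"
    by (rule sum.mono_neutral_right) (use out in auto)
  have "\<bar>\<Sum>t = 1..n. scaled_kernel K b (real t / real n - u) * f t\<bar> \<le> (\<Sum>t\<in>?S. B / b * c)"
    unfolding sum_eq
  proof (rule order_trans[OF sum_abs sum_mono])
    fix t assume t: "t \<in> ?S"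
    then have "\<bar>f t\<bar> \<le> c" using f[of t] S[of t] by simp
    then show "\<bar>scaled_kernel K b (real t / real n - u) * f t\<bar> \<le> B / b * c"
      unfolding abs_mult
      by (intro mult_mono) (use b B0 B in \<open>auto simp: scaled_kernel_def abs_mult divide_right_mono\<close>)
  qed
  also have "\<dots> = real (card ?S) * (B / b * c)"
    by simp
  also have "\<dots> \<le> (n * b + 1) * (B / b * c)"
    using card_grid_window[of "n * b" n "n * u - n * b / 2"] n b B0 c by (intro mult_right_mono) auto
  also have "\<dots> \<le> (2 * (n * b)) * (B / b * c)"
    using nb b B0 c by (intro mult_right_mono) (auto simp: mult.commute)
  also have "\<dots> = n * (2 * B * c)"
    using b by simp
  finally show ?thesis
    using n by (simp add: abs_mult field_simps)
qed

text \<open>The mean value inequality is applied to x \<mapsto> g x - g' u * x on the segment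
  between \<open>u\<close> and \<open>v\<close>. Its derivative g' x - g' u is at most \<epsilon>
  there by uniform continuity of \<open>g'\<close> on the compact interval, so \<open>d\<close> does
  not depend on \<open>u\<close>.\<close>

lemma uniform_linearization:
  fixes g g' :: "real \<Rightarrow> real"
  assumes g: "\<And>u. u \<in> {0..1} \<Longrightarrow> (g has_real_derivative g' u) (at u within {0..1})"
    and g': "continuous_on {0..1} g'" and \<epsilon>: "\<epsilon> > 0"
  obtains d where "d > 0"
    "\<And>u v. u \<in> {0..1} \<Longrightarrow> v \<in> {0..1} \<Longrightarrow> \<bar>v - u\<bar> < d \<Longrightarrow> \<bar>g v - g u - g' u * (v - u)\<bar> \<le> \<epsilon> * \<bar>v - u\<bar>"
proof -
  have "uniformly_continuous_on {0..1} g'"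
    by (rule compact_uniformly_continuous[OF g']) simp
  then obtain d where d: "d > 0" "\<And>x y. x \<in> {0..1} \<Longrightarrow> y \<in> {0..1} \<Longrightarrow> dist y x < d \<Longrightarrow> dist (g' y) (g' x) < \<epsilon>"
    using \<epsilon> unfolding uniformly_continuous_on_def by metis
  have "\<bar>g v - g u - g' u * (v - u)\<bar> \<le> \<epsilon> * \<bar>v - u\<bar>"
    if uv: "u \<in> {0..1}" "v \<in> {0..1}" "\<bar>v - u\<bar> < d" for u v
  proof -
    let ?S = "{min u v..max u v}"
    have S: "?S \<subseteq> {0..1}" using uv by auto
    have "norm ((\<lambda>x. g x - g' u * x) v - (\<lambda>x. g x - g' u * x) u) \<le> \<epsilon> * norm (v - u)"
    proof (rule field_differentiable_bound[where S = ?S and f' = "\<lambda>x. g' x - g' u"])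
      fix x assume x: "x \<in> ?S"
      then have x01: "x \<in> {0..1}" using S by blast
      have "(g has_real_derivative g' x) (at x within ?S)"
        using g[OF x01] S by (rule DERIV_subset)
      then show "((\<lambda>x. g x - g' u * x) has_real_derivative g' x - g' u) (at x within ?S)"
        by (auto intro!: derivative_eq_intros)
      have "dist x u < d" using x uv(3) by (auto simp: dist_real_def)
      then show "norm (g' x - g' u) \<le> \<epsilon>"
        using d(2)[OF uv(1) x01] by (simp add: dist_norm)
    qed auto
    then show ?thesis by (simp add: algebra_simps)
  qed
  with d(1) show ?thesis by (rule that)
qed

section \<open>Expectations: comparison with the L^q norm, and stationarity\<close>

text \<open>Convexity puts the power function above its tangent at 1. The point 0 is treated apart
  because the convexity argument lives on the open half-line. This is the pointwise form of Jensen's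
  inequality needed for the L^q norm.\<close>

lemma powr_tangent:
  fixes x q :: real
  assumes "x \<ge> 0" "q \<ge> 1"
  shows "1 + q * (x - 1) \<le> x powr q"
proof (cases "x = 0")
  case False
  have "x powr q - 1 powr q \<ge> q * (x - 1)"
  proof (rule convex_on_imp_above_tangent[where A = "{0<..}"])
    show "convex_on {0<..} (\<lambda>x. x powr q)" by (rule powr_convex) fact
    show "((\<lambda>x. x powr q) has_real_derivative q) (at 1 within {0<..})"
      by (auto intro!: derivative_eq_intros)
  qed (use False assms in \<open>auto simp: is_interval_connected interior_open\<close>)
  then show ?thesis by simp
qed (use assms in simp)

text \<open>The majorant 1 + |W|^q works, the constant being integrable under a probability
  measure.\<close>

lemma in_LqD_integrable:
  assumes "prob_space M" "q \<ge> 1" "in_Lq M q W"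
  shows "integrable M W"
proof -
  interpret prob_space M by fact
  have [measurable]: "W \<in> borel_measurable M" and int: "integrable M (\<lambda>\<omega>. \<bar>W \<omega>\<bar> powr q)"
    using assms by (auto simp: in_Lq_def)
  have "integrable M (\<lambda>\<omega>. 1 + \<bar>W \<omega>\<bar> powr q)"
    using int by simp
  then show ?thesis
  proof (rule Bochner_Integration.integrable_bound)
    have "\<bar>W \<omega>\<bar> \<le> 1 + \<bar>W \<omega>\<bar> powr q" for \<omega>
    proof (cases "\<bar>W \<omega>\<bar> \<le> 1")
      case False
      then have "\<bar>W \<omega>\<bar> powr 1 \<le> \<bar>W \<omega>\<bar> powr q" using assms(2) by (intro powr_mono) auto
      with False show ?thesis by simp
    qed (simp add: add_increasing2)
    then show "AE \<omega> in M. norm (W \<omega>) \<le> norm (1 + \<bar>W \<omega>\<bar> powr q)"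
      by (simp add: order_trans[OF _ abs_ge_self])
  qed simp
qed

text \<open>With c = E|W| > 0, the tangent inequality is integrated at |W|/c. The linear part has
  mean zero, which leaves 1 \<le> E|W|^q / c^q.\<close>

lemma expectation_le_Lq_norm:
  assumes "prob_space M" "q \<ge> 1" "in_Lq M q W"
  shows "\<bar>\<integral>\<omega>. W \<omega> \<partial>M\<bar> \<le> Lq_norm M q W"
proof -
  interpret prob_space M by fact
  have int: "integrable M (\<lambda>\<omega>. \<bar>W \<omega>\<bar> powr q)"
    using assms by (auto simp: in_Lq_def)
  have W: "integrable M W" by (rule in_LqD_integrable) fact+
  define c where "c = (\<integral>\<omega>. \<bar>W \<omega>\<bar> \<partial>M)"
  have "c \<le> Lq_norm M q W"
  proof (cases "c = 0")
    case False
    then have c: "c > 0" by (simp add: c_def less_le)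
    have "1 = (\<integral>\<omega>. 1 + q * (\<bar>W \<omega>\<bar> / c - 1) \<partial>M)"
      using W c by (simp add: c_def[symmetric] prob_space)
    also have "\<dots> \<le> (\<integral>\<omega>. (\<bar>W \<omega>\<bar> / c) powr q \<partial>M)"
    proof (rule integral_mono)
      show "integrable M (\<lambda>\<omega>. (\<bar>W \<omega>\<bar> / c) powr q)"
        using int c by (simp add: powr_divide)
    qed (use W c assms(2) powr_tangent in auto)
    also have "\<dots> = (\<integral>\<omega>. \<bar>W \<omega>\<bar> powr q \<partial>M) / c powr q"
      using c by (simp add: powr_divide)
    finally have "c powr q \<le> (\<integral>\<omega>. \<bar>W \<omega>\<bar> powr q \<partial>M)"
      using c by (simp add: field_simps)
    then have "(c powr q) powr (1 / q) \<le> (\<integral>\<omega>. \<bar>W \<omega>\<bar> powr q \<partial>M) powr (1 / q)"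
      using assms(2) by (intro powr_mono2) auto
    then show ?thesis
      using c assms(2) by (simp add: powr_powr Lq_norm_def)
  qed (simp add: Lq_norm_def)
  then show ?thesis
    using integral_abs_bound[of M W] unfolding c_def by linarith
qed

lemma in_Lq_cmult:
  assumes "in_Lq M q W"
  shows "in_Lq M q (\<lambda>\<omega>. a * W \<omega>)"
  using assms by (auto simp: in_Lq_def abs_mult powr_mult)

lemma in_Lq_diff:
  assumes "q \<ge> 1" "in_Lq M q W" "in_Lq M q Z"
  shows "in_Lq M q (\<lambda>\<omega>. W \<omega> - Z \<omega>)"
proof -
  have [measurable]: "W \<in> borel_measurable M" "Z \<in> borel_measurable M"
    using assms by (auto simp: in_Lq_def)
  have "integrable M (\<lambda>\<omega>. 2 powr q * (\<bar>W \<omega>\<bar> powr q + \<bar>Z \<omega>\<bar> powr q))"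
    using assms by (auto simp: in_Lq_def)
  then have "integrable M (\<lambda>\<omega>. \<bar>W \<omega> - Z \<omega>\<bar> powr q)"
  proof (rule Bochner_Integration.integrable_bound)
    have "\<bar>W \<omega> - Z \<omega>\<bar> powr q \<le> 2 powr q * (\<bar>W \<omega>\<bar> powr q + \<bar>Z \<omega>\<bar> powr q)" for \<omega>
    proof -
      have "\<bar>W \<omega> - Z \<omega>\<bar> powr q \<le> (2 * max \<bar>W \<omega>\<bar> \<bar>Z \<omega>\<bar>) powr q"
        using assms(1) by (intro powr_mono2) auto
      also have "\<dots> = 2 powr q * max \<bar>W \<omega>\<bar> \<bar>Z \<omega>\<bar> powr q"
        by (simp add: powr_mult)
      also have "\<dots> \<le> 2 powr q * (\<bar>W \<omega>\<bar> powr q + \<bar>Z \<omega>\<bar> powr q)"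
        by (intro mult_left_mono) (auto simp: max_def)
      finally show ?thesis .
    qed
    then show "AE \<omega> in M. norm (\<bar>W \<omega> - Z \<omega>\<bar> powr q) \<le> norm (2 powr q * (\<bar>W \<omega>\<bar> powr q + \<bar>Z \<omega>\<bar> powr q))"
      by (simp add: order_trans[OF _ abs_ge_self])
  qed simp
  then show ?thesis by (simp add: in_Lq_def)
qed

lemma expectation_diff_le_Lq_norm:
  assumes "prob_space M" "q \<ge> 1" "in_Lq M q W" "in_Lq M q Z"
  shows "\<bar>(\<integral>\<omega>. W \<omega> \<partial>M) - (\<integral>\<omega>. Z \<omega> \<partial>M)\<bar> \<le> Lq_norm M q (\<lambda>\<omega>. W \<omega> - Z \<omega>)"
  using expectation_le_Lq_norm[OF assms(1,2) in_Lq_diff[OF assms(2-4)]]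
    in_LqD_integrable[OF assms(1-3)] in_LqD_integrable[OF assms(1,2,4)] by simp

text \<open>Means of single coordinates can be read off the path law, whose shift invariance equates
  neighbouring indices. Induction in both directions then reaches every integer.\<close>

lemma stationary_process_expectation:
  assumes "stationary_process M Y"
  shows "(\<integral>\<omega>. Y t \<omega> \<partial>M) = (\<integral>\<omega>. Y 0 \<omega> \<partial>M)"
proof -
  have Y[measurable]: "Y s \<in> borel_measurable M" for s
    using assms by (simp add: stationary_process_def)
  have path[measurable]: "(\<lambda>\<omega> t. Y t \<omega>) \<in> measurable M path_space"
    unfolding path_space_def by (rule measurable_PiM_single') (auto simp: space_PiM)
  have coord[measurable]: "(\<lambda>x. x s) \<in> borel_measurable path_space" for s
    unfolding path_space_def by measurable
  have shift[measurable]: "path_shift \<in> measurable path_space path_space"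
    unfolding path_space_def path_shift_def
    by (rule measurable_PiM_single') (auto simp: space_PiM)
  have law: "(\<integral>x. x s \<partial>path_law M Y) = (\<integral>\<omega>. Y s \<omega> \<partial>M)" for s
    unfolding path_law_def by (subst integral_distr) auto
  have step: "(\<integral>\<omega>. Y (s + 1) \<omega> \<partial>M) = (\<integral>\<omega>. Y s \<omega> \<partial>M)" for s
  proof -
    have "(\<integral>\<omega>. Y s \<omega> \<partial>M) = (\<integral>x. x s \<partial>distr (path_law M Y) path_space path_shift)"
      using assms law by (simp add: stationary_process_def)
    also have "\<dots> = (\<integral>x. path_shift x s \<partial>path_law M Y)"
      by (subst integral_distr) (auto simp: path_law_def)
    also have "\<dots> = (\<integral>\<omega>. Y (s + 1) \<omega> \<partial>M)"
      by (simp add: path_shift_def law)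
    finally show ?thesis by simp
  qed
  show ?thesis
  proof (induction t rule: int_induct[where k = 0])
    case (step1 i)
    then show ?case using step[of i] by simp
  next
    case (step2 i)
    then show ?case using step[of "i - 1"] by simp
  qed simp
qed

section \<open>Bias bounds of order n^(-\<alpha>) and b^\<alpha>\<close>

lemma smoothing_kernelD:
  assumes "smoothing_kernel K"
  obtains B where "\<And>x. \<bar>K x\<bar> \<le> B" "\<And>x. x \<notin> {-1/2..1/2} \<Longrightarrow> K x = 0" "bounded_variation K"
  using assms unfolding smoothing_kernel_def bounded_iff by auto

text \<open>Positivity of the bandwidth comes from the divergence of n b_n: once the product is at
  least 1 and its factor \<open>n\<close> is nonnegative, both factors are positive.\<close>

lemma eventually_bandwidth:
  fixes b :: "nat \<Rightarrow> real"
  assumes "filterlim (\<lambda>n. real n * b n) at_top sequentially"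
  shows "\<forall>\<^sub>F n in sequentially. b n > 0 \<and> real n * b n \<ge> 1 \<and> n \<ge> 1"
proof -
  have "\<forall>\<^sub>F n in sequentially. real n * b n \<ge> 1"
    using assms by (simp add: filterlim_at_top)
  then show ?thesis
  proof (rule eventually_mono)
    fix n assume 1: "real n * b n \<ge> 1"
    then have "0 < real n * b n" by simp
    then have "b n > 0 \<and> n \<ge> 1" by (cases n) (auto simp: zero_less_mult_iff)
    with 1 show "b n > 0 \<and> real n * b n \<ge> 1 \<and> n \<ge> 1" by simp
  qed
qed

lemma approx_bias_bigo:
  assumes "prob_space M" "smoothing_kernel K" "q \<ge> 1"
    and nb: "filterlim (\<lambda>n. real n * b n) at_top sequentially"
    and S1: "cond_S1 M q \<alpha> X Xt"
  shows "approx_bias M X Xt K b \<in> O[uniformly_in (\<lambda>n. {0..1})](\<lambda>(n, u). real n powr (- \<alpha>))"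
proof -
  obtain B where B: "\<And>x. \<bar>K x\<bar> \<le> B" "\<And>x. x \<notin> {-1/2..1/2} \<Longrightarrow> K x = 0"
    using smoothing_kernelD[OF assms(2)] by metis
  have Xt: "in_Lq M q (Xt t u)" if "u \<in> {0..1}" for t u
    using S1 that by (auto simp: cond_S1_def)
  obtain C where C: "C > 0" "\<And>n t. t \<in> {1..n} \<Longrightarrow>
        in_Lq M q (\<lambda>\<omega>. X t n \<omega> - Xt (int t) (real t / real n) \<omega>) \<and>
        Lq_norm M q (\<lambda>\<omega>. X t n \<omega> - Xt (int t) (real t / real n) \<omega>) \<le> C * real n powr (- \<alpha>)"
    using S1 unfolding cond_S1_def by blast
  have diff: "\<bar>(\<integral>\<omega>. X t n \<omega> \<partial>M) - (\<integral>\<omega>. Xt (int t) (real t / real n) \<omega> \<partial>M)\<bar> \<le> C * real n powr (- \<alpha>)"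
    if t: "t \<in> {1..n}" for t n
  proof -
    let ?W = "\<lambda>\<omega>. X t n \<omega> - Xt (int t) (real t / real n) \<omega>"
    let ?Z = "Xt (int t) (real t / real n)"
    have Z: "integrable M ?Z"
      by (rule in_LqD_integrable[OF assms(1,3) Xt]) (use t in auto)
    have W: "integrable M ?W"
      by (rule in_LqD_integrable[OF assms(1,3)]) (use C t in blast)
    \<comment> \<open>Only the difference and \<open>Xt\<close> are known to lie in L^q. Adding them
      back gives integrability of \<open>X t n\<close>, which splitting the Bochner integral
      requires.\<close>
    have "integrable M (\<lambda>\<omega>. ?W \<omega> + ?Z \<omega>)"
      using Z W by (rule Bochner_Integration.integrable_add[rotated])
    then have "(\<integral>\<omega>. X t n \<omega> \<partial>M) - (\<integral>\<omega>. ?Z \<omega> \<partial>M) = (\<integral>\<omega>. ?W \<omega> \<partial>M)"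
      using Z by simp
    then show ?thesis
      using expectation_le_Lq_norm[OF assms(1,3), of ?W] C(2)[OF t] by auto
  qed
  show ?thesis
  proof (rule bigoI[where c = "2 * B * C"], unfold eventually_uniformly_in)
    show "\<forall>\<^sub>F n in sequentially. \<forall>u\<in>{0..1}. norm (approx_bias M X Xt K b (n, u)) \<le>
      2 * B * C * norm (case (n, u) of (n, u) \<Rightarrow> real n powr (- \<alpha>))"
      using eventually_bandwidth[OF nb]
    proof eventually_elim
      case (elim n)
      show ?case
      proof
        fix u :: real
        show "norm (approx_bias M X Xt K b (n, u)) \<le> 2 * B * C * norm (case (n, u) of (n, u) \<Rightarrow> real n powr (- \<alpha>))"
          using kernel_weighted_mean_bound[where K = K and u = u and c = "C * real n powr (- \<alpha>)", OF B _ _ _ diff, of "b n" n]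
            elim C(1) by (simp add: approx_bias_def mult.assoc)
      qed
    qed
  qed
qed

lemma smoothing_bias_eq:
  assumes "\<And>u. u \<in> {0..1} \<Longrightarrow> stationary_process M (\<lambda>t. Xt t u)"
  shows "smoothing_bias M Xt K b (n, u) =
    1 / real n * (\<Sum>t = 1..n. scaled_kernel K (b n) (real t / real n - u) *
      ((\<integral>\<omega>. Xt 0 (real t / real n) \<omega> \<partial>M) - (\<integral>\<omega>. Xt 0 u \<omega> \<partial>M)))"
proof -
  have "(\<integral>\<omega>. Xt (int t) (real t / real n) \<omega> \<partial>M) = (\<integral>\<omega>. Xt 0 (real t / real n) \<omega> \<partial>M)" if "t \<in> {1..n}" for t
    using that by (intro stationary_process_expectation[OF assms]) auto
  then show ?thesis
    unfolding smoothing_bias_def by (auto intro!: sum.cong)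
qed

lemma smoothing_bias_bigo:
  assumes "prob_space M" "smoothing_kernel K" "q \<ge> 1"
    and stat: "\<And>u. u \<in> {0..1} \<Longrightarrow> stationary_process M (\<lambda>t. Xt t u)"
    and nb: "filterlim (\<lambda>n. real n * b n) at_top sequentially"
    and S1: "cond_S1 M q \<alpha> X Xt"
  shows "smoothing_bias M Xt K b \<in> O[uniformly_in (\<lambda>n. {0..1})](\<lambda>(n, u). b n powr \<alpha>)"
proof -
  obtain B where B: "\<And>x. \<bar>K x\<bar> \<le> B" "\<And>x. x \<notin> {-1/2..1/2} \<Longrightarrow> K x = 0"
    using smoothing_kernelD[OF assms(2)] by metis
  have Xt: "in_Lq M q (Xt t u)" if "u \<in> {0..1}" for t u
    using S1 that by (auto simp: cond_S1_def)
  have \<alpha>: "\<alpha> > 0" using S1 by (simp add: cond_S1_def)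
  obtain C where C: "C > 0" "\<And>n t u v. t \<in> {1..n} \<Longrightarrow> u \<in> {0..1} \<Longrightarrow> v \<in> {0..1} \<Longrightarrow>
      Lq_norm M q (\<lambda>\<omega>. Xt (int t) u \<omega> - Xt (int t) v \<omega>) \<le> C * \<bar>u - v\<bar> powr \<alpha>"
    using S1 unfolding cond_S1_def by blast
  have diff: "\<bar>(\<integral>\<omega>. Xt 0 v \<omega> \<partial>M) - (\<integral>\<omega>. Xt 0 u \<omega> \<partial>M)\<bar> \<le> C * \<bar>v - u\<bar> powr \<alpha>"
    if uv: "u \<in> {0..1}" "v \<in> {0..1}" for u v
  proof -
    \<comment> \<open>\<open>cond_S1\<close> gives the Hoelder bound for indices t \<ge> 1 only, so
      it is used at index 1 and carried to index 0 by stationarity.\<close>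
    have "\<bar>(\<integral>\<omega>. Xt 1 v \<omega> \<partial>M) - (\<integral>\<omega>. Xt 1 u \<omega> \<partial>M)\<bar> \<le> C * \<bar>v - u\<bar> powr \<alpha>"
      using expectation_diff_le_Lq_norm[OF assms(1,3) Xt Xt, of v u 1 1] C(2)[of 1 1 v u] uv by simp
    then show ?thesis
      using stationary_process_expectation[OF stat, of u 1] stationary_process_expectation[OF stat, of v 1] uv
      by simp
  qed
  show ?thesis
  proof (rule bigoI[where c = "2 * B * C"], unfold eventually_uniformly_in)
    show "\<forall>\<^sub>F n in sequentially. \<forall>u\<in>{0..1}. norm (smoothing_bias M Xt K b (n, u)) \<le>
      2 * B * C * norm (case (n, u) of (n, u) \<Rightarrow> b n powr \<alpha>)"
      using eventually_bandwidth[OF nb]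
    proof eventually_elim
      case (elim n)
      show ?case
      proof
        fix u :: real assume u: "u \<in> {0..1}"
        have bias_eq: "smoothing_bias M Xt K b (n, u) =
            1 / real n * (\<Sum>t = 1..n. scaled_kernel K (b n) (real t / real n - u) *
              ((\<integral>\<omega>. Xt 0 (real t / real n) \<omega> \<partial>M) - (\<integral>\<omega>. Xt 0 u \<omega> \<partial>M)))"
          by (rule smoothing_bias_eq) (rule stat)
        have "\<bar>smoothing_bias M Xt K b (n, u)\<bar> \<le> 2 * B * (C * b n powr \<alpha>)"
          unfolding bias_eq
        proof (rule kernel_weighted_mean_bound[OF B])
          fix t assume t: "t \<in> {1..n}" "\<bar>real t / real n - u\<bar> \<le> b n / 2"
          then have "\<bar>(\<integral>\<omega>. Xt 0 (real t / real n) \<omega> \<partial>M) - (\<integral>\<omega>. Xt 0 u \<omega> \<partial>M)\<bar>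
            \<le> C * \<bar>real t / real n - u\<bar> powr \<alpha>"
            using u by (intro diff) auto
          also have "\<dots> \<le> C * b n powr \<alpha>"
            using t(2) C(1) \<alpha> elim by (intro mult_left_mono powr_mono2) auto
          finally show "\<bar>(\<integral>\<omega>. Xt 0 (real t / real n) \<omega> \<partial>M) - (\<integral>\<omega>. Xt 0 u \<omega> \<partial>M)\<bar> \<le> C * b n powr \<alpha>" .
        qed (use elim C(1) in auto)
        then show "norm (smoothing_bias M Xt K b (n, u)) \<le> 2 * B * C * norm (case (n, u) of (n, u) \<Rightarrow> b n powr \<alpha>)"
          by (simp add: mult.assoc)
      qed
    qed
  qed
qed

section \<open>Expansion for a continuously differentiable mean\<close>

lemma smoothing_bias_small_if_C1:
  assumes "smoothing_kernel K" and sym: "\<And>x. K (- x) = K x"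
    and stat: "\<And>u. u \<in> {0..1} \<Longrightarrow> stationary_process M (\<lambda>t. Xt t u)"
    and b0: "b \<longlonglongrightarrow> 0" and nb: "filterlim (\<lambda>n. real n * b n) at_top sequentially"
    and deriv: "\<And>u. u \<in> {0..1} \<Longrightarrow> ((\<lambda>u. \<integral>\<omega>. Xt 0 u \<omega> \<partial>M) has_real_derivative g' u) (at u within {0..1})"
    and cont: "continuous_on {0..1} g'"
  shows "smoothing_bias_small M Xt K b"
proof -
  obtain B where B: "\<And>x. \<bar>K x\<bar> \<le> B" "\<And>x. x \<notin> {-1/2..1/2} \<Longrightarrow> K x = 0" and bv: "bounded_variation K"
    using smoothing_kernelD[OF assms(1)] by metis
  obtain C where C: "\<And>n b u. n \<ge> 1 \<Longrightarrow> b > 0 \<Longrightarrow> u \<in> {b / 2..1 - b / 2} \<Longrightarrow>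
    \<bar>\<Sum>t = 1..n. scaled_kernel K b (real t / real n - u) * (real t / real n - u)\<bar> \<le> C"
    by (rule kernel_first_moment_bound[OF bv B sym], assumption, rule that)
  define g where "g u = (\<integral>\<omega>. Xt 0 u \<omega> \<partial>M)" for u
  define U where "U n = {b n / 2..1 - b n / 2}" for n
  \<comment> \<open>\<open>r2\<close> is the linear Taylor term, controlled by the first moment
    bound. \<open>r1\<close> is defined as the rest, so that the decomposition is an identity at
    every pair (n, u) and not merely for large \<open>n\<close>.\<close>
  define r2 where "r2 = (\<lambda>(n, u). g' u *
    (1 / real n * (\<Sum>t = 1..n. scaled_kernel K (b n) (real t / real n - u) * (real t / real n - u))))"
  define r1 where "r1 p = smoothing_bias M Xt K b p - r2 p" for p
  have U01: "u \<in> {0..1}" if "b n > 0" "u \<in> U n" for n u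
    using that by (auto simp: U_def)
  have B0: "0 \<le> B" using B(1)[of 0] by linarith
  have "bounded (g' ` {0..1})"
    by (intro compact_imp_bounded compact_continuous_image cont) simp
  then obtain A where "\<forall>x\<in>g' ` {0..1}. norm x \<le> A"
    unfolding bounded_iff by blast
  then have A: "\<bar>g' u\<bar> \<le> A" if "u \<in> {0..1}" for u
    using that by simp
  have A0: "0 \<le> A" using A[of 0] by simp
  have "r2 \<in> O[uniformly_in U](\<lambda>(n, u). 1 / real n)"
  proof (rule bigoI[where c = "A * C"], unfold eventually_uniformly_in)
    show "\<forall>\<^sub>F n in sequentially. \<forall>u\<in>U n. norm (r2 (n, u)) \<le> A * C * norm (case (n, u) of (n, u) \<Rightarrow> 1 / real n)"
      using eventually_bandwidth[OF nb]
    proof eventually_elim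
      case (elim n)
      show ?case
      proof
        fix u assume u: "u \<in> U n"
        let ?S = "\<Sum>t = 1..n. scaled_kernel K (b n) (real t / real n - u) * (real t / real n - u)"
        have "\<bar>g' u\<bar> * \<bar>?S\<bar> \<le> A * C"
        proof (rule mult_mono)
          show "\<bar>g' u\<bar> \<le> A" using elim u by (intro A U01[of n]) auto
          show "\<bar>?S\<bar> \<le> C" by (rule C) (use elim u in \<open>auto simp: U_def\<close>)
        qed (use A0 in auto)
        then show "norm (r2 (n, u)) \<le> A * C * norm (case (n, u) of (n, u) \<Rightarrow> 1 / real n)"
          by (simp add: r2_def abs_mult divide_right_mono)
      qed
    qed
  qed
  moreover have "r1 \<in> o[uniformly_in U](\<lambda>(n, u). b n)"
  proof (rule landau_o.smallI, unfold eventually_uniformly_in)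
    fix c :: real assume c: "c > 0"
    \<comment> \<open>The weighted mean will be at most 2 B \<epsilon> b/2 = B \<epsilon> b.
      Dividing by B + 1 makes this at most c b and also covers B = 0.\<close>
    define \<epsilon> where "\<epsilon> = c / (B + 1)"
    have \<epsilon>: "\<epsilon> > 0" using c B0 by (simp add: \<epsilon>_def)
    obtain d where d: "d > 0" "\<And>u v. u \<in> {0..1} \<Longrightarrow> v \<in> {0..1} \<Longrightarrow> \<bar>v - u\<bar> < d \<Longrightarrow>
      \<bar>g v - g u - g' u * (v - u)\<bar> \<le> \<epsilon> * \<bar>v - u\<bar>"
      using uniform_linearization[OF deriv[folded g_def] cont \<epsilon>] by metis
    have "\<forall>\<^sub>F n in sequentially. b n < d"
      using b0 d(1) by (rule order_tendstoD)
    with eventually_bandwidth[OF nb]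
    show "\<forall>\<^sub>F n in sequentially. \<forall>u\<in>U n. norm (r1 (n, u)) \<le> c * norm (case (n, u) of (n, u) \<Rightarrow> b n)"
    proof eventually_elim
      case (elim n)
      show ?case
      proof
        fix u assume u: "u \<in> U n"
        then have u01: "u \<in> {0..1}" using U01 elim by blast
        have bias_eq: "smoothing_bias M Xt K b (n, u) =
            1 / real n * (\<Sum>t = 1..n. scaled_kernel K (b n) (real t / real n - u) * (g (real t / real n) - g u))"
          unfolding g_def by (rule smoothing_bias_eq) (rule stat)
        have linear: "(\<Sum>t = 1..n. k t * (G t - a * z t)) = (\<Sum>t = 1..n. k t * G t) - a * (\<Sum>t = 1..n. k t * z t)"
          for k G z :: "nat \<Rightarrow> real" and a
          by (simp add: right_diff_distrib sum_subtractf sum_distrib_left mult.left_commute)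
        have r1_eq: "r1 (n, u) = 1 / real n * (\<Sum>t = 1..n. scaled_kernel K (b n) (real t / real n - u) *
            (g (real t / real n) - g u - g' u * (real t / real n - u)))"
          unfolding r1_def bias_eq r2_def prod.case linear by (simp only: right_diff_distrib mult.left_commute)
        have "\<bar>r1 (n, u)\<bar> \<le> 2 * B * (\<epsilon> * (b n / 2))"
          unfolding r1_eq
        proof (rule kernel_weighted_mean_bound[OF B])
          fix t assume t: "t \<in> {1..n}" "\<bar>real t / real n - u\<bar> \<le> b n / 2"
          then have "\<bar>real t / real n - u\<bar> < d" using elim by linarith
          moreover have "real t / real n \<in> {0..1}" using t(1) by auto
          ultimately have "\<bar>g (real t / real n) - g u - g' u * (real t / real n - u)\<bar> \<le> \<epsilon> * \<bar>real t / real n - u\<bar>"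
            by (intro d(2) u01)
          also have "\<dots> \<le> \<epsilon> * (b n / 2)"
            using t(2) \<epsilon> by (intro mult_left_mono) auto
          finally show "\<bar>g (real t / real n) - g u - g' u * (real t / real n - u)\<bar> \<le> \<epsilon> * (b n / 2)" .
        qed (use elim \<epsilon> in auto)
        also have "\<dots> = B / (B + 1) * (c * b n)"
          using B0 by (simp add: \<epsilon>_def field_simps)
        also have "\<dots> \<le> 1 * (c * b n)"
          using B0 c elim by (intro mult_right_mono) auto
        finally show "norm (r1 (n, u)) \<le> c * norm (case (n, u) of (n, u) \<Rightarrow> b n)"
          using elim by simp
      qed
    qed
  qed
  moreover have "smoothing_bias M Xt K b = (\<lambda>p. r1 p + r2 p)"
    by (simp add: r1_def)
  ultimately show ?thesis
    unfolding smoothing_bias_small_def U_def by blast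
qed

section \<open>Continuous differentiability of the mean in cases (a) and (b)\<close>

text \<open>By the mean value inequality the integrable supremum of |D| dominates all difference
  quotients as well as the derivative itself. Dominated convergence therefore yields both the
  derivative of the mean and its continuity.\<close>

lemma expectation_C1_if_pathwise_C1:
  fixes Y :: "real \<Rightarrow> 'a \<Rightarrow> real"
  assumes "prob_space M" "q \<ge> 1" and Y: "\<And>u. u \<in> {0..1} \<Longrightarrow> in_Lq M q (Y u)"
    and path: "AE \<omega> in M.
      (\<forall>u\<in>{0..1}. ((\<lambda>v. Y v \<omega>) has_real_derivative D u \<omega>) (at u within {0..1})) \<and>
      continuous_on {0..1} (\<lambda>u. D u \<omega>)"
    and sup: "in_Lq M q (\<lambda>\<omega>. SUP u\<in>{0..1}. \<bar>D u \<omega>\<bar>)"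
  obtains g' where
    "\<And>u. u \<in> {0..1} \<Longrightarrow> ((\<lambda>u. \<integral>\<omega>. Y u \<omega> \<partial>M) has_real_derivative g' u) (at u within {0..1})"
    "continuous_on {0..1} g'"
proof -
  define Z where "Z \<omega> = (SUP u\<in>{0..1}. \<bar>D u \<omega>\<bar>)" for \<omega>
  have Z: "integrable M Z"
    using in_LqD_integrable[OF assms(1,2) sup] by (simp add: Z_def[abs_def])
  have Y_meas: "Y u \<in> borel_measurable M" if "u \<in> {0..1}" for u
    using Y[OF that] by (simp add: in_Lq_def)
  have Y_int: "integrable M (Y u)" if "u \<in> {0..1}" for u
    using in_LqD_integrable[OF assms(1,2) Y[OF that]] .
  \<comment> \<open>Nonzero steps tending to 0, taken forward from the left half of the interval and
    backward from the right half. Their size is at most 1/2, so u + s u n never leaves [0, 1]. They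
    do not depend on \<omega>, which keeps the quotients measurable.\<close>
  define s :: "real \<Rightarrow> nat \<Rightarrow> real" where
    "s u n = (if u \<le> 1 / 2 then 1 / 2 else - 1 / 2) * inverse (real (Suc n))" for u n
  have s0: "s u n \<noteq> 0" for u n by (simp add: s_def)
  have s_lim: "(\<lambda>n. u + s u n) \<longlonglongrightarrow> u" for u
    unfolding s_def using tendsto_add[OF tendsto_const tendsto_mult[OF tendsto_const LIMSEQ_inverse_real_of_nat]]
    by fastforce
  have s_in: "u + s u n \<in> {0..1}" if "u \<in> {0..1}" for u n
  proof -
    define i where "i = inverse (real (Suc n))"
    have "0 \<le> i" "i \<le> 1"
      by (auto simp: i_def field_simps)
    moreover have "s u n = (if u \<le> 1 / 2 then i / 2 else - i / 2)"
      by (simp add: s_def i_def)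
    ultimately show ?thesis using that by auto
  qed
  \<comment> \<open>\<open>D u\<close> need not be measurable; \<open>E u\<close> is a measurable version of it, agreeing for all \<open>u\<close> off one null set.\<close>
  define E where "E u \<omega> = lim (\<lambda>n. (Y (u + s u n) \<omega> - Y u \<omega>) / (u + s u n - u))" for u \<omega>
  have E_meas: "E u \<in> borel_measurable M" if "u \<in> {0..1}" for u
    unfolding E_def using Y_meas[OF that] Y_meas[OF s_in[OF that]]
    by (intro borel_measurable_lim_metric) auto
  have quot: "(\<lambda>n. (Y (x n) \<omega> - Y u \<omega>) / (x n - u)) \<longlonglongrightarrow> d"
    if "((\<lambda>v. Y v \<omega>) has_real_derivative d) (at u within {0..1})"
      "\<And>n. x n \<in> {0..1} - {u}" "x \<longlonglongrightarrow> u" for \<omega> u d and x :: "nat \<Rightarrow> real"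
    using that unfolding has_field_derivative_iff tendsto_at_iff_sequentially comp_def by blast
  have good: "AE \<omega> in M. (\<forall>u\<in>{0..1}. E u \<omega> = D u \<omega> \<and> \<bar>D u \<omega>\<bar> \<le> Z \<omega> \<and>
      ((\<lambda>v. Y v \<omega>) has_real_derivative D u \<omega>) (at u within {0..1}) \<and>
      (\<forall>v\<in>{0..1}. \<bar>Y v \<omega> - Y u \<omega>\<bar> \<le> Z \<omega> * \<bar>v - u\<bar>)) \<and> continuous_on {0..1} (\<lambda>u. D u \<omega>)"
    using path
  proof eventually_elim
    case (elim \<omega>)
    \<comment> \<open>A real \<open>SUP\<close> is an upper bound only for a set bounded above;
      continuity of the path of \<open>D\<close> on a compact interval supplies this before
      \<open>Z\<close> can serve as majorant.\<close>
    have "compact ((\<lambda>u. \<bar>D u \<omega>\<bar>) ` {0..1})"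
      using elim by (intro compact_continuous_image continuous_intros) auto
    then have "bdd_above ((\<lambda>u. \<bar>D u \<omega>\<bar>) ` {0..1})"
      by (intro bounded_imp_bdd_above compact_imp_bounded)
    then have DZ: "\<bar>D u \<omega>\<bar> \<le> Z \<omega>" if "u \<in> {0..1}" for u
      unfolding Z_def using that by (rule cSUP_upper[rotated])
    have "E u \<omega> = D u \<omega>" if u: "u \<in> {0..1}" for u
      unfolding E_def
      by (rule limI, rule quot) (use elim u s_in s0 s_lim in auto)
    moreover have "\<bar>Y v \<omega> - Y u \<omega>\<bar> \<le> Z \<omega> * \<bar>v - u\<bar>" if "u \<in> {0..1}" "v \<in> {0..1}" for u v
      using field_differentiable_bound[where S = "{0..1::real}" and f = "\<lambda>v. Y v \<omega>" and f' = "\<lambda>u. D u \<omega>" and B = "Z \<omega>"]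
        elim DZ that by (simp add: convex_real_interval)
    ultimately show ?case
      using elim DZ by blast
  qed
  have "((\<lambda>u. \<integral>\<omega>. Y u \<omega> \<partial>M) has_real_derivative (\<integral>\<omega>. E u \<omega> \<partial>M)) (at u within {0..1})"
    if u: "u \<in> {0..1}" for u
    unfolding has_field_derivative_iff tendsto_at_iff_sequentially comp_def
  proof (intro allI impI)
    fix x :: "nat \<Rightarrow> real" assume x: "\<forall>i. x i \<in> {0..1} - {u}" "x \<longlonglongrightarrow> u"
    then have x01: "x i \<in> {0..1}" and xu: "x i \<noteq> u" for i by auto
    have "(\<lambda>i. \<integral>\<omega>. (Y (x i) \<omega> - Y u \<omega>) / (x i - u) \<partial>M) \<longlonglongrightarrow> (\<integral>\<omega>. E u \<omega> \<partial>M)"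
    proof (rule integral_dominated_convergence[where w = Z])
      show "AE \<omega> in M. (\<lambda>i. (Y (x i) \<omega> - Y u \<omega>) / (x i - u)) \<longlonglongrightarrow> E u \<omega>"
        using good
      proof eventually_elim
        case (elim \<omega>)
        then have "E u \<omega> = D u \<omega>" and d: "((\<lambda>v. Y v \<omega>) has_real_derivative D u \<omega>) (at u within {0..1})"
          using u by auto
        then show ?case
          using quot[OF d] x by simp
      qed
      show "AE \<omega> in M. norm ((Y (x i) \<omega> - Y u \<omega>) / (x i - u)) \<le> Z \<omega>" for i
        using good
      proof eventually_elim
        case (elim \<omega>)
        then have "\<bar>Y (x i) \<omega> - Y u \<omega>\<bar> \<le> Z \<omega> * \<bar>x i - u\<bar>"
          using u x01 by blast
        then show ?case
          using xu[of i] by (simp add: abs_divide pos_divide_le_eq)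
      qed
    qed (use E_meas Y_meas u x01 Z in auto)
    then show "(\<lambda>i. ((\<integral>\<omega>. Y (x i) \<omega> \<partial>M) - (\<integral>\<omega>. Y u \<omega> \<partial>M)) / (x i - u)) \<longlonglongrightarrow> (\<integral>\<omega>. E u \<omega> \<partial>M)"
      using Y_int u x01 by simp
  qed
  \<comment> \<open>Here \<open>good\<close> must hold for all parameters off one null set, since
    the values at every \<open>x n\<close> and at \<open>u\<close> are compared along the same
    path.\<close>
  moreover have "continuous_on {0..1} (\<lambda>u. \<integral>\<omega>. E u \<omega> \<partial>M)"
  proof (rule continuous_on_sequentiallyI)
    fix x :: "nat \<Rightarrow> real" and u
    assume x: "\<forall>n. x n \<in> {0..1}" "u \<in> {0..1}" "x \<longlonglongrightarrow> u"
    show "(\<lambda>n. \<integral>\<omega>. E (x n) \<omega> \<partial>M) \<longlonglongrightarrow> (\<integral>\<omega>. E u \<omega> \<partial>M)"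
    proof (rule integral_dominated_convergence[where w = Z])
      show "AE \<omega> in M. (\<lambda>i. E (x i) \<omega>) \<longlonglongrightarrow> E u \<omega>"
        using good
      proof eventually_elim
        case (elim \<omega>)
        then have "(\<lambda>i. D (x i) \<omega>) \<longlonglongrightarrow> D u \<omega>"
          using x unfolding continuous_on_sequentially comp_def by blast
        then show ?case using elim x by simp
      qed
      show "AE \<omega> in M. norm (E (x i) \<omega>) \<le> Z \<omega>" for i
        using good x by (auto elim!: eventually_mono)
    qed (use E_meas x Z in auto)
  qed
  ultimately show ?thesis by (rule that)
qed

text \<open>Expectation is a linear functional on L^q of norm at most 1, hence carries L^q limits to
  limits of real numbers: of the difference quotients, and of \<open>D v\<close> as \<open>v\<close>
  tends to \<open>u\<close>.\<close>

lemma expectation_C1_if_Lq_C1: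
  fixes Y :: "real \<Rightarrow> 'a \<Rightarrow> real"
  assumes "prob_space M" "q \<ge> 1" and YD: "Lq_frechet_deriv M q Y D" and D: "Lq_continuous M q D"
  shows "u \<in> {0..1} \<Longrightarrow> ((\<lambda>u. \<integral>\<omega>. Y u \<omega> \<partial>M) has_real_derivative (\<integral>\<omega>. D u \<omega> \<partial>M)) (at u within {0..1})"
    and "continuous_on {0..1} (\<lambda>u. \<integral>\<omega>. D u \<omega> \<partial>M)"
proof -
  have D_in: "in_Lq M q (D u)" and Y_in: "in_Lq M q (Y u)" if "u \<in> {0..1}" for u
    using YD that by (auto simp: Lq_frechet_deriv_def)
  show "continuous_on {0..1} (\<lambda>u. \<integral>\<omega>. D u \<omega> \<partial>M)"
    unfolding continuous_on_def
  proof
    fix u :: real assume u: "u \<in> {0..1}"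
    have "((\<lambda>v. (\<integral>\<omega>. D v \<omega> \<partial>M) - (\<integral>\<omega>. D u \<omega> \<partial>M)) \<longlongrightarrow> 0) (at u within {0..1})"
    proof (rule Lim_null_comparison)
      show "\<forall>\<^sub>F v in at u within {0..1}. norm ((\<integral>\<omega>. D v \<omega> \<partial>M) - (\<integral>\<omega>. D u \<omega> \<partial>M)) \<le> Lq_norm M q (\<lambda>\<omega>. D v \<omega> - D u \<omega>)"
        unfolding eventually_at_filter real_norm_def
        by (intro always_eventually allI impI expectation_diff_le_Lq_norm[OF assms(1,2)] D_in u)
      show "((\<lambda>v. Lq_norm M q (\<lambda>\<omega>. D v \<omega> - D u \<omega>)) \<longlongrightarrow> 0) (at u within {0..1})"
        using D u by (simp add: Lq_continuous_def)
    qed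
    then show "((\<lambda>u. \<integral>\<omega>. D u \<omega> \<partial>M) \<longlongrightarrow> (\<integral>\<omega>. D u \<omega> \<partial>M)) (at u within {0..1})"
      by (rule LIM_zero_cancel)
  qed
  assume u: "u \<in> {0..1}"
  let ?g = "\<lambda>u. \<integral>\<omega>. Y u \<omega> \<partial>M" and ?d = "\<integral>\<omega>. D u \<omega> \<partial>M"
  have "((\<lambda>h. (?g (u + h) - ?g u) / h - ?d) \<longlongrightarrow> 0) (at 0 within {h. u + h \<in> {0..1}})"
  proof (rule Lim_null_comparison)
    have "\<bar>(?g (u + h) - ?g u) / h - ?d\<bar> \<le> Lq_norm M q (\<lambda>\<omega>. (Y (u + h) \<omega> - Y u \<omega>) / h - D u \<omega>)"
      if h: "u + h \<in> {0..1}" for h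
      using expectation_diff_le_Lq_norm[OF assms(1,2)
          in_Lq_cmult[OF in_Lq_diff[OF assms(2) Y_in[OF h] Y_in[OF u]], of "1 / h"] D_in[OF u]]
        in_LqD_integrable[OF assms(1,2) Y_in[OF h]] in_LqD_integrable[OF assms(1,2) Y_in[OF u]]
      by simp
    then show "\<forall>\<^sub>F h in at 0 within {h. u + h \<in> {0..1}}. norm ((?g (u + h) - ?g u) / h - ?d) \<le>
        Lq_norm M q (\<lambda>\<omega>. (Y (u + h) \<omega> - Y u \<omega>) / h - D u \<omega>)"
      by (auto simp: eventually_at_filter)
    show "((\<lambda>h. Lq_norm M q (\<lambda>\<omega>. (Y (u + h) \<omega> - Y u \<omega>) / h - D u \<omega>)) \<longlongrightarrow> 0)
        (at 0 within {h. u + h \<in> {0..1}})"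
      using YD u by (simp add: Lq_frechet_deriv_def)
  qed
  then have "((\<lambda>h. (?g (u + h) - ?g u) / h) \<longlongrightarrow> ?d) (at 0 within {h. u + h \<in> {0..1}})"
    by (rule LIM_zero_cancel)
  \<comment> \<open>The substitution h = y - u turns the limit over increments into one over points
    of [0, 1]; at the endpoints both are one-sided.\<close>
  moreover have "filterlim (\<lambda>y. y - u) (at 0 within {h. u + h \<in> {0..1}}) (at u within {0..1})"
    unfolding filterlim_at
    by (auto simp: eventually_at_filter intro!: tendsto_eq_intros)
  ultimately have "((\<lambda>y. (?g (u + (y - u)) - ?g u) / (y - u)) \<longlongrightarrow> ?d) (at u within {0..1})"
    by (rule filterlim_compose)
  then show "(?g has_real_derivative ?d) (at u within {0..1})"
    by (simp add: has_field_derivative_iff)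
qed

section \<open>The bias expansions\<close>

theorem proposition3p3:
  fixes M :: "'a measure"
    and X :: "nat \<Rightarrow> nat \<Rightarrow> 'a \<Rightarrow> real"
    and Xt :: "int \<Rightarrow> real \<Rightarrow> 'a \<Rightarrow> real"
    and K :: "real \<Rightarrow> real"
    and b :: "nat \<Rightarrow> real"
    and q \<alpha> :: real
  assumes "prob_space M"
    and "\<And>n t. t \<in> {1..n} \<Longrightarrow> X t n \<in> borel_measurable M"
    and "\<And>u. u \<in> {0..1} \<Longrightarrow> stationary_process M (\<lambda>t. Xt t u)"
    and "\<And>u. u \<in> {0..1} \<Longrightarrow> ergodic_process M (\<lambda>t. Xt t u)"
    and "smoothing_kernel K"
    and "q \<ge> 1"
    and "b \<longlonglongrightarrow> 0"
    and "filterlim (\<lambda>n. real n * b n) at_top sequentially"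
    and "cond_S1 M q \<alpha> X Xt"
  shows
    "approx_bias M X Xt K b \<in> O[uniformly_in (\<lambda>n. {0..1})](\<lambda>(n, u). real n powr (- \<alpha>)) \<and>
     (\<exists>r\<^sub>1 \<in> O[uniformly_in (\<lambda>n. {0..1})](\<lambda>(n, u). b n powr \<alpha>).
      \<exists>r\<^sub>2 \<in> O[uniformly_in (\<lambda>n. {0..1})](\<lambda>(n, u). 1 / real n).
        smoothing_bias M Xt K b = (\<lambda>p. r\<^sub>1 p + r\<^sub>2 p)) \<and>
     ((\<forall>x. K (- x) = K x) \<longrightarrow>
        (cond_S3 M q \<alpha> Xt \<longrightarrow>
           approx_bias M X Xt K b \<in> O[uniformly_in (\<lambda>n. {0..1})](\<lambda>(n, u). 1 / real n) \<and>
           smoothing_bias_small M Xt K b) \<and>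
        (\<forall>D. Lq_frechet_deriv M q (Xt 0) D \<longrightarrow>
           (\<alpha> = 1 \<longrightarrow>
              approx_bias M X Xt K b \<in> O[uniformly_in (\<lambda>n. {0..1})](\<lambda>(n, u). 1 / real n)) \<and>
           (Lq_continuous M q D \<longrightarrow> smoothing_bias_small M Xt K b)))"
proof (intro conjI impI allI)
  show approx: "approx_bias M X Xt K b \<in> O[uniformly_in (\<lambda>n. {0..1})](\<lambda>(n, u). real n powr (- \<alpha>))"
    by (rule approx_bias_bigo[OF assms(1,5,6,8,9)])
  have "smoothing_bias M Xt K b \<in> O[uniformly_in (\<lambda>n. {0..1})](\<lambda>(n, u). b n powr \<alpha>)"
    by (rule smoothing_bias_bigo[OF assms(1,5,6,3,8,9)])
  then show "\<exists>r\<^sub>1 \<in> O[uniformly_in (\<lambda>n. {0..1})](\<lambda>(n, u). b n powr \<alpha>).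
      \<exists>r\<^sub>2 \<in> O[uniformly_in (\<lambda>n. {0..1})](\<lambda>(n, u). 1 / real n).
        smoothing_bias M Xt K b = (\<lambda>p. r\<^sub>1 p + r\<^sub>2 p)"
    \<comment> \<open>The whole bias is already O(b^\<alpha>), because the differences are centred
      at \<open>u\<close> inside the sum and no Riemann sum is compared with an integral. Hence the
      second remainder is taken to be 0.\<close>
    by (intro bexI[where x = "smoothing_bias M Xt K b"] bexI[where x = "\<lambda>_. 0"]) auto
  show approx1: "approx_bias M X Xt K b \<in> O[uniformly_in (\<lambda>n. {0..1})](\<lambda>(n, u). 1 / real n)" if "\<alpha> = 1"
  proof -
    \<comment> \<open>The functions agree at n = 0 too, where both are 0 by convention.\<close>
    have "(\<lambda>(n, u). real n powr - \<alpha>) = (\<lambda>(n :: nat, u :: real). 1 / real n)"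
      using that by (auto simp: fun_eq_iff powr_minus_divide)
    with approx show ?thesis by simp
  qed
  show "approx_bias M X Xt K b \<in> O[uniformly_in (\<lambda>n. {0..1})](\<lambda>(n, u). 1 / real n)" if "cond_S3 M q \<alpha> Xt"
    using that by (intro approx1) (simp add: cond_S3_def)
  assume "\<forall>x. K (- x) = K x"
  \<comment> \<open>Cases (a) and (b) meet here: they differ only in how a continuous derivative of
    the mean is obtained.\<close>
  then have small: "smoothing_bias_small M Xt K b"
    if "\<And>u. u \<in> {0..1} \<Longrightarrow> ((\<lambda>u. \<integral>\<omega>. Xt 0 u \<omega> \<partial>M) has_real_derivative g' u) (at u within {0..1})"
      "continuous_on {0..1} g'" for g'
    using smoothing_bias_small_if_C1[OF assms(5) _ assms(3,7,8) that] by blast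
  show "smoothing_bias_small M Xt K b" if "cond_S3 M q \<alpha> Xt"
  proof -
    obtain D where "AE \<omega> in M.
        (\<forall>u\<in>{0..1}. ((\<lambda>v. Xt 0 v \<omega>) has_real_derivative D 0 u \<omega>) (at u within {0..1})) \<and>
        continuous_on {0..1} (\<lambda>u. D 0 u \<omega>)"
      "in_Lq M q (\<lambda>\<omega>. SUP u\<in>{0..1}. \<bar>D (0 :: int) u \<omega>\<bar>)"
      using \<open>cond_S3 M q \<alpha> Xt\<close> unfolding cond_S3_def by blast
    moreover have "in_Lq M q (Xt 0 u)" if "u \<in> {0..1}" for u
      using assms(9) that by (simp add: cond_S1_def)
    ultimately show ?thesis
      using expectation_C1_if_pathwise_C1[OF assms(1,6), of "Xt 0" "D 0"] small by metis
  qed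
  show "smoothing_bias_small M Xt K b"
    if "Lq_frechet_deriv M q (Xt 0) D" "Lq_continuous M q D" for D
    by (rule small[OF expectation_C1_if_Lq_C1[OF assms(1,6) that]])
qed

end
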